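(* Given a $k$-bounded space online static bin packing algorithm whose cost on every static instance is at most $c\cdot\mathrm{OPT}^S+\ell$, where $\mathrm{OPT}^S$ is the optimal number of bins for that instance, there exists an online non-clairvoyant algorithm for the dynamic bin packing problem whose average cost (total cost divided by $T$) on every instance is at most $$c\cdot\mu\cdot\mathrm{OPT}_{avg}+\max\{k,\ell\}.$$
   Context: Static bin packing: items of sizes in $(0,1]$ are packed into unit-capacity bins and never depart; the cost is the number of bins used. An online static bin packing algorithm packs items one at a time irrevocably; it is $k$-bounded space if, for each new item, the number of bins in which it can be packed (the active bins) is at most $k$. Dynamic bin packing. Time is discretized into steps $t=1,\dots,T$. An instance is a finite set of intervals $I=[s_I,e_I)$ with integer endpoints and size $w_I\in(0,1]$; $I$ is active at $t$ if $s_I\le t<e_I$. Lengths $e_I-s_I$ are normalized so that the minimum is $1$; $\mu$ is the maximum length. At each time step at least one interval is active. Each interval is assigned to one machine for its entire duration (no migration); at each time the total size of active intervals on a machine is at most $1$. A machine is active at $t$ if some interval assigned to it is active at $t$. The total cost is the total active time summed over all machines; $\mathrm{OPT}$ is the minimum (offline) cost and $\mathrm{OPT}_{avg}=\mathrm{OPT}/T$. An online algorithm must assign each interval irrevocably upon arrival; it is non-clairvoyant if, upon arrival of an interval, it learns its size but nothing about its length/departure time. *)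

theory Defs
  imports Complex_Main
begin

section \<open>Static bin packing\<close>

text \<open>An instance is the sequence of item sizes in order of arrival. A packing maps the position
  of each item to the name of its bin.\<close>

definition static_instance :: "real list \<Rightarrow> bool" where
  "static_instance xs \<longleftrightarrow> (\<forall>x\<in>set xs. 0 < x \<and> x \<le> 1)"

definition static_feasible :: "real list \<Rightarrow> (nat \<Rightarrow> nat) \<Rightarrow> bool" where
  "static_feasible xs f \<longleftrightarrow> (\<forall>b. (\<Sum>i | i < length xs \<and> f i = b. xs ! i) \<le> 1)"

definition bins_used :: "real list \<Rightarrow> (nat \<Rightarrow> nat) \<Rightarrow> nat set" where
  "bins_used xs f = f ` {..<length xs}"

definition static_cost :: "real list \<Rightarrow> (nat \<Rightarrow> nat) \<Rightarrow> nat" where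
  "static_cost xs f = card (bins_used xs f)"

text \<open>The infimum is a minimum: it ranges over a set of naturals which, on every instance, is
  nonempty because each item fits into a bin of its own.\<close>

definition static_opt :: "real list \<Rightarrow> nat" where
  "static_opt xs = Inf {static_cost xs f | f. static_feasible xs f}"

text \<open>A deterministic online algorithm maps the nonempty sequence of the items seen so far to the
  bin of the last one. Its earlier decisions are determined by the proper prefixes.\<close>

type_synonym static_alg = "real list \<Rightarrow> nat"

definition static_run :: "static_alg \<Rightarrow> real list \<Rightarrow> nat \<Rightarrow> nat" where
  "static_run A xs i = A (take (Suc i) xs)"

definition online_static :: "static_alg \<Rightarrow> bool" where
  "online_static A \<longleftrightarrow> (\<forall>xs. static_instance xs \<longrightarrow> static_feasible xs (static_run A xs))"

text \<open>The set \<open>act xs\<close> consists of the bins that are active after \<open>xs\<close> has been packed. A bin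
  becomes active only by receiving its first item, and a bin that has been closed stays closed. An
  item that is not put into one of the at most \<open>k\<close> active bins opens a new bin, and some active bin
  may be closed at that moment; thus Next Fit is 1-bounded space.\<close>

definition bounded_space :: "nat \<Rightarrow> static_alg \<Rightarrow> bool" where
  "bounded_space k A \<longleftrightarrow>
    (\<exists>act :: real list \<Rightarrow> nat set.
      (\<forall>xs. static_instance xs \<longrightarrow>
        act xs \<subseteq> bins_used xs (static_run A xs) \<and> card (act xs) \<le> k) \<and>
      (\<forall>xs x. static_instance (xs @ [x]) \<longrightarrow>
        (A (xs @ [x]) \<in> act xs \<or> A (xs @ [x]) \<notin> bins_used xs (static_run A xs)) \<and>
        act (xs @ [x]) \<subseteq> insert (A (xs @ [x])) (act xs)))"


section \<open>Dynamic bin packing\<close>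

datatype job = Job (arr: nat) (dep: nat) (wt: real)

definition active_at :: "job \<Rightarrow> nat \<Rightarrow> bool" where
  "active_at I t \<longleftrightarrow> arr I \<le> t \<and> t < dep I"

definition len :: "job \<Rightarrow> nat" where
  "len I = dep I - arr I"

text \<open>An instance lists its intervals in order of arrival. Since all lists sorted by arrival time are
  admitted, intervals may be repeated and simultaneous arrivals are presented in any order. As every
  time step is covered, \<open>T\<close> is determined by the intervals.\<close>

definition dyn_instance :: "nat \<Rightarrow> job list \<Rightarrow> bool" where
  "dyn_instance T Is \<longleftrightarrow>
    1 \<le> T \<and>
    sorted (map arr Is) \<and>
    (\<forall>I\<in>set Is. 1 \<le> arr I \<and> arr I < dep I \<and> dep I \<le> T + 1 \<and> 0 < wt I \<and> wt I \<le> 1) \<and>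
    Min (len ` set Is) = 1 \<and>
    (\<forall>t\<in>{1..T}. \<exists>I\<in>set Is. active_at I t)"

definition max_len :: "job list \<Rightarrow> nat" where
  "max_len Is = Max (len ` set Is)"

text \<open>An assignment maps the position of each interval to the name of its machine.\<close>

definition dyn_feasible :: "job list \<Rightarrow> (nat \<Rightarrow> nat) \<Rightarrow> bool" where
  "dyn_feasible Is f \<longleftrightarrow>
    (\<forall>m t. (\<Sum>i | i < length Is \<and> f i = m \<and> active_at (Is ! i) t. wt (Is ! i)) \<le> 1)"

definition machine_active :: "job list \<Rightarrow> (nat \<Rightarrow> nat) \<Rightarrow> nat \<Rightarrow> nat \<Rightarrow> bool" where
  "machine_active Is f m t \<longleftrightarrow> (\<exists>i<length Is. f i = m \<and> active_at (Is ! i) t)"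

definition dyn_cost :: "job list \<Rightarrow> (nat \<Rightarrow> nat) \<Rightarrow> nat" where
  "dyn_cost Is f = (\<Sum>m\<in>f ` {..<length Is}. card {t. machine_active Is f m t})"

definition dyn_opt :: "job list \<Rightarrow> nat" where
  "dyn_opt Is = Inf {dyn_cost Is f | f. dyn_feasible Is f}"

definition dyn_opt_avg :: "nat \<Rightarrow> job list \<Rightarrow> real" where
  "dyn_opt_avg T Is = real (dyn_opt Is) / real T"

text \<open>What a non-clairvoyant algorithm knows about an interval at time \<open>t\<close>: its arrival time and size,
  and its departure time only if it has already departed.\<close>

type_synonym observation = "nat \<times> real \<times> nat option"

definition observe :: "nat \<Rightarrow> job \<Rightarrow> observation" where
  "observe t I = (arr I, wt I, if dep I \<le> t then Some (dep I) else None)"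

text \<open>An online non-clairvoyant algorithm maps the observations, made at the arrival of an interval, of
  all intervals that have arrived so far (the new one comes last) to the machine of the new one.\<close>

type_synonym dyn_alg = "observation list \<Rightarrow> nat"

definition dyn_run :: "dyn_alg \<Rightarrow> job list \<Rightarrow> nat \<Rightarrow> nat" where
  "dyn_run B Is i = B (map (observe (arr (Is ! i))) (take (Suc i) Is))"

definition online_nonclairvoyant :: "dyn_alg \<Rightarrow> bool" where
  "online_nonclairvoyant B \<longleftrightarrow> (\<forall>T Is. dyn_instance T Is \<longrightarrow> dyn_feasible Is (dyn_run B Is))"

end

(*
  Run the static algorithm on the sizes in order of arrival, one machine per bin, and let N(t) be
  the number of bins opened up to time t. Every interval active at time t > mu arrived after
  t - mu, so its bin was either opened after t - mu or is one of the at most k bins still active at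
  the end of step t - mu. Hence at most k + N(t) - N(t - mu) machines are active at t, and at most
  N(t) if t <= mu. Summing over t telescopes to a total cost of at most k (T - mu) + mu N(T).
  Finally N(T) <= c OPT^S + l, and OPT^S is at most the dynamic optimum, since naming bins by pairs
  (machine, arrival time) turns a dynamic assignment into a static packing.
*)
theory Submission
  imports Defs "HOL-Library.Nat_Bijection"
begin

section \<open>Static packings\<close>

text \<open>With bin names all distinct, every bin holds at most one item. Applied to the identity,
  this makes the sets under \<open>Inf\<close> nonempty in both the static and the dynamic setting,
  so that the optima are attained.\<close>

lemma static_feasible_inj:
  assumes "inj f" "static_instance xs"
  shows "static_feasible xs f"
  unfolding static_feasible_def
proof
  fix b
  show "(\<Sum>i | i < length xs \<and> f i = b. xs ! i) \<le> 1"
  proof (cases "\<exists>j<length xs. f j = b")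
    case True
    then obtain j where j: "j < length xs" "f j = b" by blast
    then have "{i. i < length xs \<and> f i = b} = {j}"
      using assms(1) by (auto dest: injD)
    then show ?thesis using j assms(2) by (simp add: static_instance_def)
  next
    case False
    then have empty: "{i. i < length xs \<and> f i = b} = {}" by auto
    show ?thesis unfolding empty by simp
  qed
qed

lemma static_opt_le:
  assumes "static_feasible xs f"
  shows "static_opt xs \<le> static_cost xs f"
  unfolding static_opt_def using assms by (intro cInf_lower) auto

lemma static_opt_attained:
  assumes "static_instance xs"
  obtains f where "static_feasible xs f" "static_cost xs f = static_opt xs"
proof -
  have "{static_cost xs f | f. static_feasible xs f} \<noteq> {}"
    using static_feasible_inj[OF inj_on_id assms] by auto
  from Inf_nat_def1[OF this] show thesis
    using that unfolding static_opt_def by auto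
qed

text \<open>Two items of size 1 cannot share a bin, so any feasible packing is injective on
  positions. This family provides instances of arbitrarily large optimum.\<close>

lemma static_opt_replicate: "static_opt (replicate n 1) = n"
proof -
  have inst: "static_instance (replicate n 1)"
    by (auto simp: static_instance_def)
  obtain f where f: "static_feasible (replicate n 1) f"
      "static_cost (replicate n 1) f = static_opt (replicate n 1)"
    using static_opt_attained[OF inst] .
  have "inj_on f {..<n}"
  proof (rule inj_onI, rule ccontr)
    fix i j assume ij: "i \<in> {..<n}" "j \<in> {..<n}" "f i = f j" "i \<noteq> j"
    have "(\<Sum>p\<in>{i, j}. replicate n (1::real) ! p)
        \<le> (\<Sum>p | p < length (replicate n (1::real)) \<and> f p = f j. replicate n 1 ! p)"
      using ij by (intro sum_mono2) auto
    also have "\<dots> \<le> 1" using f(1) unfolding static_feasible_def by blast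
    finally show False using ij by simp
  qed
  then have "static_cost (replicate n 1) f = n"
    by (simp add: static_cost_def bins_used_def card_image)
  with f(2) show ?thesis by simp
qed

text \<open>A negative \<open>c\<close> would push the guaranteed bound below 0 on sufficiently many
  unit items, while costs are nonnegative. The sign is what later permits replacing the static
  optimum by the larger dynamic one.\<close>

lemma static_ratio_nonneg:
  fixes c l :: real
  assumes "\<And>xs. static_instance xs \<Longrightarrow>
             real (static_cost xs (static_run A xs)) \<le> c * real (static_opt xs) + l"
  shows "0 \<le> c"
proof (rule ccontr)
  assume "\<not> 0 \<le> c"
  then obtain n where n: "l < real n * (- c)"
    using reals_Archimedean3[of "- c"] by auto
  have "static_instance (replicate n 1)" by (auto simp: static_instance_def)
  from assms[OF this] have "0 \<le> c * real n + l"
    using of_nat_0_le_iff[where 'a=real] order_trans by (fastforce simp: static_opt_replicate)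
  with n show False by (simp add: algebra_simps)
qed

lemma static_run_take: "i < n \<Longrightarrow> static_run A (take n xs) i = static_run A xs i"
  by (simp add: static_run_def min_def)

lemma bins_used_take:
  "n \<le> length xs \<Longrightarrow> bins_used (take n xs) (static_run A (take n xs)) = static_run A xs ` {..<n}"
  by (auto simp: bins_used_def static_run_take intro!: image_cong)

text \<open>A bin already in use receives a further item only while it is active, and a closed bin
  never reopens. So every bin used both before and after position \<open>n\<close> is active after
  the first \<open>n\<close> items.\<close>

lemma bounded_space_card_reused:
  assumes "bounded_space k A" "static_instance xs" "n \<le> length xs"
  shows "card (static_run A xs ` {n..<length xs} \<inter> static_run A xs ` {..<n}) \<le> k"
proof -
  let ?f = "static_run A xs"
  obtain act where
    act: "\<And>ys. static_instance ys \<Longrightarrow>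
            act ys \<subseteq> bins_used ys (static_run A ys) \<and> card (act ys) \<le> k"
    and step: "\<And>ys y. static_instance (ys @ [y]) \<Longrightarrow>
            (A (ys @ [y]) \<in> act ys \<or> A (ys @ [y]) \<notin> bins_used ys (static_run A ys)) \<and>
            act (ys @ [y]) \<subseteq> insert (A (ys @ [y])) (act ys)"
    using assms(1) unfolding bounded_space_def by blast
  have prefix: "static_instance (take j xs)" for j
    using assms(2) by (auto simp: static_instance_def dest: in_set_takeD)
  have step': "(?f j \<in> act (take j xs) \<or> ?f j \<notin> ?f ` {..<j}) \<and>
      act (take (Suc j) xs) \<subseteq> insert (?f j) (act (take j xs))" if "j < length xs" for j
    using step[of "take j xs" "xs ! j"] that prefix[of "Suc j"]
    by (simp add: take_Suc_conv_app_nth[symmetric] bins_used_take flip: static_run_def)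
  \<comment> \<open>Only the bin of item \<open>j\<close> can enter the active set at that step; if
    that bin was used earlier, it must have been active already.\<close>
  have old: "act (take j xs) \<inter> ?f ` {..<n} \<subseteq> act (take n xs)" if "n \<le> j" "j \<le> length xs" for j
    using that
  proof (induction j rule: dec_induct)
    case (step j)
    have j: "j < length xs" using step.prems by simp
    show ?case
    proof
      fix b assume b: "b \<in> act (take (Suc j) xs) \<inter> ?f ` {..<n}"
      then have "b \<in> ?f ` {..<j}" using step.hyps by auto
      with b step'[OF j] have "b \<in> act (take j xs)" by (metis IntD1 insertE subsetD)
      with b step.IH j show "b \<in> act (take n xs)" by auto
    qed
  qed simp
  have "?f ` {n..<length xs} \<inter> ?f ` {..<n} \<subseteq> act (take n xs)"
  proof
    fix b assume b: "b \<in> ?f ` {n..<length xs} \<inter> ?f ` {..<n}"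
    then obtain j where j: "n \<le> j" "j < length xs" "b = ?f j" by auto
    have "b \<in> ?f ` {..<j}" using b j by auto
    with step'[OF j(2)] j(3) have "b \<in> act (take j xs)" by simp
    with b j old[of j] show "b \<in> act (take n xs)" by auto
  qed
  moreover have "finite (act (take n xs))"
    using act[OF prefix, of n] by (auto simp: bins_used_def intro: finite_subset)
  ultimately show ?thesis
    using act[OF prefix, of n] by (meson card_mono order_trans)
qed


section \<open>Dynamic assignments\<close>

lemma dyn_instance_static: "dyn_instance T Is \<Longrightarrow> static_instance (map wt Is)"
  by (auto simp: dyn_instance_def static_instance_def)

lemma dyn_instance_nth:
  assumes "dyn_instance T Is" "i < length Is"
  shows "1 \<le> arr (Is ! i)" "arr (Is ! i) < dep (Is ! i)" "dep (Is ! i) \<le> T + 1" "0 < wt (Is ! i)"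
  using assms by (auto simp: dyn_instance_def)

lemma dep_le_arr_max_len:
  assumes "i < length Is"
  shows "dep (Is ! i) \<le> arr (Is ! i) + max_len Is"
proof -
  have "len (Is ! i) \<le> max_len Is"
    unfolding max_len_def using assms by (intro Max_ge) auto
  then show ?thesis by (simp add: len_def)
qed

lemma max_len_le:
  assumes "dyn_instance T Is"
  shows "max_len Is \<le> T"
proof -
  have "set Is \<noteq> {}" using assms by (force simp: dyn_instance_def)
  moreover have "\<forall>I\<in>set Is. len I \<le> T"
    using assms by (auto simp: dyn_instance_def len_def)
  ultimately show ?thesis by (simp add: max_len_def)
qed

text \<open>Static feasibility bounds the load of everything ever placed in a bin; departures only
  lower it.\<close>

lemma static_feasible_imp_dyn_feasible:
  assumes "dyn_instance T Is" "static_feasible (map wt Is) f"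
  shows "dyn_feasible Is f"
  unfolding dyn_feasible_def
proof (intro allI)
  fix m t
  have "(\<Sum>i | i < length Is \<and> f i = m \<and> active_at (Is ! i) t. wt (Is ! i))
      \<le> (\<Sum>i | i < length (map wt Is) \<and> f i = m. map wt Is ! i)"
    using dyn_instance_nth(4)[OF assms(1)]
    by (intro sum_le_included[where i = id]) (auto intro: less_imp_le)
  also have "\<dots> \<le> 1" using assms(2) unfolding static_feasible_def by blast
  finally show "(\<Sum>i | i < length Is \<and> f i = m \<and> active_at (Is ! i) t. wt (Is ! i)) \<le> 1" .
qed

lemma machine_active_time:
  assumes "dyn_instance T Is" "machine_active Is f m t"
  shows "t \<in> {1..T}"
  using assms dyn_instance_nth[OF assms(1)]
  by (fastforce simp: machine_active_def active_at_def)

text \<open>Double counting of pairs (machine, time): the window argument bounds the number of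
  active machines at each time step.\<close>

lemma dyn_cost_eq_sum_time:
  assumes "dyn_instance T Is"
  shows "dyn_cost Is f = (\<Sum>t\<in>{1..T}. card {m. machine_active Is f m t})"
proof -
  let ?M = "f ` {..<length Is}"
  have "dyn_cost Is f = (\<Sum>m\<in>?M. card {t\<in>{1..T}. machine_active Is f m t})"
    unfolding dyn_cost_def using machine_active_time[OF assms]
    by (intro sum.cong refl arg_cong[where f = card]) auto
  also have "\<dots> = (\<Sum>t\<in>{1..T}. card {m\<in>?M. machine_active Is f m t})"
    by (rule sum_multicount_gen) simp_all
  also have "\<dots> = (\<Sum>t\<in>{1..T}. card {m. machine_active Is f m t})"
    by (intro sum.cong refl arg_cong[where f = card]) (auto simp: machine_active_def)
  finally show ?thesis .
qed

text \<open>Items arriving on one machine at the same time are active together at that moment, so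
  they fit into one bin. Distinct bins of this kind belong to distinct pairs (machine, time) at
  which the machine is active, and the dynamic cost counts these pairs.\<close>

lemma static_opt_le_dyn_opt:
  assumes "dyn_instance T Is"
  shows "static_opt (map wt Is) \<le> dyn_opt Is"
proof -
  have "{dyn_cost Is f | f. dyn_feasible Is f} \<noteq> {}"
    using static_feasible_imp_dyn_feasible[OF assms
        static_feasible_inj[OF inj_on_id dyn_instance_static[OF assms]]] by auto
  from Inf_nat_def1[OF this] obtain g where
    g: "dyn_feasible Is g" "dyn_cost Is g = dyn_opt Is"
    unfolding dyn_opt_def by auto
  define f where "f i = prod_encode (g i, arr (Is ! i))" for i
  have active: "active_at (Is ! i) (arr (Is ! i))" if "i < length Is" for i
    using dyn_instance_nth[OF assms that] by (simp add: active_at_def)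
  have fin: "finite {t. machine_active Is g m t}" for m
    by (rule finite_subset[of _ "{1..T}"]) (use machine_active_time[OF assms] in auto)
  have "static_feasible (map wt Is) f"
    unfolding static_feasible_def
  proof
    fix b
    obtain m a where b: "b = prod_encode (m, a)"
      by (metis prod_decode_inverse surj_pair)
    have "(\<Sum>i | i < length (map wt Is) \<and> f i = b. map wt Is ! i)
        \<le> (\<Sum>i | i < length Is \<and> g i = m \<and> active_at (Is ! i) a. wt (Is ! i))"
      using dyn_instance_nth(4)[OF assms] active
      by (intro sum_le_included[where i = id])
         (auto simp: b f_def prod_encode_eq intro: less_imp_le)
    also have "\<dots> \<le> 1" using g(1) unfolding dyn_feasible_def by blast
    finally show "(\<Sum>i | i < length (map wt Is) \<and> f i = b. map wt Is ! i) \<le> 1" .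
  qed
  then have "static_opt (map wt Is) \<le> static_cost (map wt Is) f"
    by (rule static_opt_le)
  also have "\<dots> \<le> card (SIGMA m:g ` {..<length Is}. {t. machine_active Is g m t})"
  proof -
    let ?S = "SIGMA m:g ` {..<length Is}. {t. machine_active Is g m t}"
    have "bins_used (map wt Is) f \<subseteq> prod_encode ` ?S"
      using active by (force simp: bins_used_def f_def machine_active_def)
    then show ?thesis
      unfolding static_cost_def using fin
      by (intro surj_card_le) auto
  qed
  also have "\<dots> = dyn_cost Is g"
    unfolding dyn_cost_def using fin by (subst card_SigmaI) auto
  finally show ?thesis using g(2) by simp
qed


section \<open>The cost of a bounded space assignment\<close>

text \<open>Intended reading: \<open>a t\<close> machines are active at \<open>t\<close>,
  \<open>N t\<close> bins have been opened by then, \<open>w\<close> is the maximum length and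
  \<open>M\<close> the final number of bins. After telescoping, only the last \<open>w\<close> terms
  of \<open>N\<close> survive.\<close>

lemma sum_telescope_window:
  fixes a N :: "nat \<Rightarrow> nat"
  assumes le: "\<And>t. a t \<le> N t"
    and window: "\<And>t. a (t + w) + N t \<le> N (t + w) + k"
    and bound: "\<And>t. N t \<le> M"
    and "w \<le> T"
  shows "(\<Sum>t\<in>{1..T}. a t) \<le> k * (T - w) + w * M"
proof -
  \<comment> \<open>The additive form avoids truncated subtraction. The base case covers the first
    \<open>w\<close> steps by \<open>a t \<le> N t\<close>; each further step adds one window
    inequality.\<close>
  have *: "(\<Sum>t\<in>{1..w + d}. a t) + (\<Sum>t\<in>{1..d}. N t) \<le> k * d + (\<Sum>t\<in>{1..w + d}. N t)" for d
  proof (induction d)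
    case 0
    show ?case using le by (simp add: sum_mono)
  next
    case (Suc d)
    then show ?case using window[of "Suc d"] by (simp add: add.commute)
  qed
  define d where "d = T - w"
  have T: "T = d + w" using assms(4) by (simp add: d_def)
  have "(\<Sum>t\<in>{1..d + w}. N t) = (\<Sum>t\<in>{1..d}. N t) + (\<Sum>t\<in>{d + 1..d + w}. N t)"
    by (rule sum.ub_add_nat) simp
  moreover have "(\<Sum>t\<in>{d + 1..d + w}. N t) \<le> w * M"
    using sum_bounded_above[of "{d + 1..d + w}" N M] bound by simp
  ultimately show ?thesis
    using *[of d] by (simp add: T add.commute)
qed

text \<open>Translates a moment in time into a position in the item sequence, where the bounded
  space property can be applied.\<close>

lemma sorted_arr_prefix:
  assumes "sorted (map arr Is)"
  obtains n where "n \<le> length Is" "{i. i < length Is \<and> arr (Is ! i) \<le> t} = {..<n}"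
proof
  let ?n = "length (takeWhile (\<lambda>I. arr I \<le> t) Is)"
  show n: "?n \<le> length Is" by (rule length_takeWhile_le)
  show "{i. i < length Is \<and> arr (Is ! i) \<le> t} = {..<?n}"
  proof (intro set_eqI iffI)
    fix i assume "i \<in> {i. i < length Is \<and> arr (Is ! i) \<le> t}"
    then have i: "i < length Is" "arr (Is ! i) \<le> t" by auto
    show "i \<in> {..<?n}"
    proof (rule ccontr)
      assume "i \<notin> {..<?n}"
      then have "?n \<le> i" by simp
      then have "arr (Is ! ?n) \<le> arr (Is ! i)"
        using sorted_nth_mono[OF assms, of ?n i] i by simp
      with i \<open>?n \<le> i\<close> nth_length_takeWhile[of "\<lambda>I. arr I \<le> t" Is] show False by simp
    qed
  next
    fix i assume "i \<in> {..<?n}"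
    then have "i < ?n" by simp
    with n set_takeWhileD[OF nth_mem[OF this]] show "i \<in> {i. i < length Is \<and> arr (Is ! i) \<le> t}"
      by (simp add: takeWhile_nth)
  qed
qed

lemma dyn_cost_static_run_le:
  assumes "bounded_space k A" "dyn_instance T Is"
  shows "dyn_cost Is (static_run A (map wt Is))
    \<le> k * (T - max_len Is) + max_len Is * static_cost (map wt Is) (static_run A (map wt Is))"
proof -
  let ?f = "static_run A (map wt Is)" and ?L = "length Is" and ?w = "max_len Is"
  define D where "D t = {i. i < ?L \<and> arr (Is ! i) \<le> t}" for t
  define a where "a t = card {m. machine_active Is ?f m t}" for t
  have finD: "finite (D t)" for t by (simp add: D_def)
  have active_sub: "{m. machine_active Is ?f m t} \<subseteq> ?f ` D t" for t
    by (auto simp: machine_active_def active_at_def D_def)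
  have "a t \<le> card (?f ` D t)" for t
    unfolding a_def using active_sub finD by (intro card_mono) auto
  moreover have "a (t + ?w) + card (?f ` D t) \<le> card (?f ` D (t + ?w)) + k" for t
  proof -
    have "sorted (map arr Is)" using assms(2) by (simp add: dyn_instance_def)
    then obtain n where n: "n \<le> ?L" "D t = {..<n}"
      unfolding D_def by (rule sorted_arr_prefix)
    \<comment> \<open>The old bins that are reused at any later position, even after
      \<open>t + ?w\<close>; this larger set still has at most \<open>k\<close> elements.\<close>
    let ?R = "?f ` {n..<?L} \<inter> ?f ` {..<n}"
    have "{m. machine_active Is ?f m (t + ?w)} \<subseteq> (?f ` D (t + ?w) - ?f ` D t) \<union> ?R"
    proof
      fix m assume m: "m \<in> {m. machine_active Is ?f m (t + ?w)}"
      then obtain i where i: "i < ?L" "?f i = m" "active_at (Is ! i) (t + ?w)"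
        by (auto simp: machine_active_def)
      \<comment> \<open>The departure is after \<open>t + ?w\<close> and at most \<open>?w\<close>
        after the arrival, so the arrival is strictly after \<open>t\<close>.\<close>
      then have "i \<notin> D t"
        using dep_le_arr_max_len[OF i(1)] by (simp add: D_def active_at_def)
      then have "m \<in> ?f ` {n..<?L}" using i n by auto
      then show "m \<in> (?f ` D (t + ?w) - ?f ` D t) \<union> ?R"
        using m active_sub n(2) by blast
    qed
    then have "a (t + ?w) \<le> card ((?f ` D (t + ?w) - ?f ` D t) \<union> ?R)"
      unfolding a_def using finD by (intro card_mono) auto
    also have "\<dots> \<le> card (?f ` D (t + ?w) - ?f ` D t) + card ?R"
      by (rule card_Un_le)
    also have "card (?f ` D (t + ?w) - ?f ` D t) = card (?f ` D (t + ?w)) - card (?f ` D t)"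
      using finD by (intro card_Diff_subset) (auto simp: D_def)
    finally have "a (t + ?w) \<le> card (?f ` D (t + ?w)) - card (?f ` D t) + card ?R" .
    moreover have "card ?R \<le> k"
      using bounded_space_card_reused[OF assms(1) dyn_instance_static[OF assms(2)], of n] n(1)
      by simp
    \<comment> \<open>Ensures that the natural subtraction above is not truncated.\<close>
    moreover have "card (?f ` D t) \<le> card (?f ` D (t + ?w))"
      using finD by (intro card_mono image_mono) (auto simp: D_def)
    ultimately show ?thesis by linarith
  qed
  moreover have "card (?f ` D t) \<le> static_cost (map wt Is) ?f" for t
    unfolding static_cost_def bins_used_def by (intro card_mono image_mono) (auto simp: D_def)
  ultimately have "(\<Sum>t\<in>{1..T}. a t) \<le> k * (T - ?w) + ?w * static_cost (map wt Is) ?f"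
    by (rule sum_telescope_window) (rule max_len_le[OF assms(2)])
  then show ?thesis
    by (simp add: dyn_cost_eq_sum_time[OF assms(2)] a_def)
qed

theorem lemma1p4:
  fixes A :: static_alg and k :: nat and c l :: real
  assumes "online_static A"
    and "bounded_space k A"
    and "\<And>xs. static_instance xs \<Longrightarrow>
           real (static_cost xs (static_run A xs)) \<le> c * real (static_opt xs) + l"
  shows "\<exists>B :: dyn_alg. online_nonclairvoyant B \<and>
           (\<forall>T Is. dyn_instance T Is \<longrightarrow>
              real (dyn_cost Is (dyn_run B Is)) / real T
                \<le> c * real (max_len Is) * dyn_opt_avg T Is + max (real k) l)"
proof -
  \<comment> \<open>Only the sizes are passed on, so the run is the same whatever departures have
    been observed.\<close>
  define B :: dyn_alg where "B obs = A (map (\<lambda>(_, w, _). w) obs)" for obs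
  have run: "dyn_run B Is = static_run A (map wt Is)" for Is
    by (rule ext) (simp add: dyn_run_def B_def static_run_def observe_def take_map comp_def)
  have "online_nonclairvoyant B"
    unfolding online_nonclairvoyant_def run
    using assms(1) static_feasible_imp_dyn_feasible dyn_instance_static
    by (auto simp: online_static_def)
  moreover have "real (dyn_cost Is (dyn_run B Is)) / real T
      \<le> c * real (max_len Is) * dyn_opt_avg T Is + max (real k) l"
    if inst: "dyn_instance T Is" for T Is
  proof -
    let ?w = "max_len Is" and ?M = "max (real k) l"
    let ?N = "static_cost (map wt Is) (static_run A (map wt Is))"
    have T: "0 < real T" using inst by (simp add: dyn_instance_def)
    have w: "?w \<le> T" using max_len_le[OF inst] .
    have "real ?N \<le> c * real (static_opt (map wt Is)) + l"
      using assms(3) dyn_instance_static[OF inst] .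
    also have "\<dots> \<le> c * real (dyn_opt Is) + ?M"
      using static_ratio_nonneg[OF assms(3)] static_opt_le_dyn_opt[OF inst]
      by (intro add_mono mult_left_mono) auto
    finally have N: "real ?N \<le> c * real (dyn_opt Is) + ?M" .
    have "real (dyn_cost Is (dyn_run B Is)) \<le> real (k * (T - ?w) + ?w * ?N)"
      unfolding run of_nat_le_iff by (rule dyn_cost_static_run_le[OF assms(2) inst])
    also have "\<dots> = real k * (real T - real ?w) + real ?w * real ?N"
      using w by (simp add: of_nat_diff)
    \<comment> \<open>Raising both \<open>k\<close> and \<open>l\<close> to \<open>?M\<close> lets
      the weights \<open>T - ?w\<close> and \<open>?w\<close> recombine to
      \<open>?M * T\<close>.\<close>
    also have "\<dots> \<le> ?M * (real T - real ?w) + real ?w * (c * real (dyn_opt Is) + ?M)"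
      using w N by (intro add_mono mult_right_mono mult_left_mono) auto
    also have "\<dots> = c * real ?w * real (dyn_opt Is) + ?M * real T"
      by (simp add: algebra_simps)
    finally have "real (dyn_cost Is (dyn_run B Is)) / real T
        \<le> (c * real ?w * real (dyn_opt Is) + ?M * real T) / real T"
      using T by (intro divide_right_mono) auto
    then show ?thesis
      using T by (simp add: dyn_opt_avg_def add_divide_distrib)
  qed
  ultimately show ?thesis by blast
qed

end
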